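(* Let $\mathcal{D} = [\underline{x}, \overline{x}]$ be a compact interval, let $f : \mathcal{D} \to \mathbb{R}$ be continuously differentiable, let $\varepsilon > 0$, and let $\mathcal{D}_{\mathrm{loc}} = [\underline{t}, \overline{t}] \subseteq \mathcal{D}$ with $\underline{t} < \overline{t}$. Consider the following requirements on a triple $(a,b,c) \in \mathbb{R}^3$: (i) $a x^2 + b x + c \geq f(x) - \varepsilon$ for all $x \in \mathcal{D}_{\mathrm{loc}}$; (ii) $a x^2 + b x + c \leq f(x)$ for all $x \in \mathcal{D}$; (iii) $a \underline{t}^2 + b \underline{t} + c = f(\underline{t}) - \varepsilon$ and $a \overline{t}^2 + b \overline{t} + c = f(\overline{t}) - \varepsilon$. If there exists a triple $(a,b,c)$ fulfilling (i), (ii) and (iii), then the inner-loop method (defined in the context), run on the input $\underline{t}, \overline{t}$, either returns such a triple after finitely many iterations, or runs forever and the generated sequence $(a_l, b_l, c_l)_{l \in \mathbb{N}_0}$ converges to such a triple. If no such triple exists, the inner-loop method returns "Infeasible" (after finitely many iterations).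
   Context: For $x \in \mathcal{D} \setminus \{\underline{t}, \overline{t}\}$ define $$A(x) = \frac{f(x) - f(\underline{t}) + \varepsilon}{(x - \underline{t})(x - \overline{t})} - \frac{f(\overline{t}) - f(\underline{t})}{(\overline{t} - \underline{t})(x - \overline{t})}, \qquad B(x) = \frac{f(x) - f(\underline{t})}{(x - \underline{t})(x - \overline{t})} - \frac{f(\overline{t}) - f(\underline{t})}{(\overline{t} - \underline{t})(x - \overline{t})}.$$ For given $a_l \in \mathbb{R}$, let $(b_l, c_l)$ be the unique solution of the linear system $a_l \underline{t}^2 + b_l \underline{t} + c_l = f(\underline{t}) - \varepsilon$, $a_l \overline{t}^2 + b_l \overline{t} + c_l = f(\overline{t}) - \varepsilon$ (unique since $\underline{t} < \overline{t}$), and put $p_l(x) = a_l x^2 + b_l x + c_l$. Write $\mathrm{int}(\mathcal{D}_{\mathrm{loc}}) = (\underline{t}, \overline{t})$. The inner-loop method (an idealized procedure in exact real arithmetic, in which global maximization of a function of one variable is an available operation): 1. Initialize $l = 0$, $\underline{a}_0 = -\infty$, and $$\overline{a}_0 = \min\left\{ \frac{f(\overline{t}) - f(\underline{t}) + (\underline{t} - \overline{t}) f'(\underline{t})}{(\overline{t} - \underline{t})^2},\ \frac{f(\underline{t}) - f(\overline{t}) + (\overline{t} - \underline{t}) f'(\overline{t})}{(\overline{t} - \underline{t})^2} \right\}.$$ Set $a_0 = \overline{a}_0$ and compute $(b_0, c_0)$. 2. While $\underline{a}_l \leq \overline{a}_l$, do the following. - Compute maximizers $x^1, x^2, x^3$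 and the values $v_1, v_2, v_3$ of the three problems $$v_1 = \sup_{x \in \mathcal{D} \setminus \mathcal{D}_{\mathrm{loc}}} p_l(x) - f(x), \quad v_2 = \sup_{x \in \mathrm{int}(\mathcal{D}_{\mathrm{loc}})} p_l(x) - f(x), \quad v_3 = \sup_{x \in \mathrm{int}(\mathcal{D}_{\mathrm{loc}})} f(x) - p_l(x) - \varepsilon,$$ and set $v_{\max} = \max\{v_1, v_2, v_3\}$. (The supremum over the empty set is $-\infty$; if a supremum is not attained, there is no corresponding point $x^i$, and the corresponding term is omitted in the update below.) - If $v_{\max} \leq 0$, return $(a_l, b_l, c_l)$ and stop. - Otherwise update $\underline{a}_{l+1} = \max\{\underline{a}_l, A(x^2)\}$ and $\overline{a}_{l+1} = \min\{\overline{a}_l, A(x^1), B(x^3)\}$, increment $l$ by one, set $a_l = \overline{a}_l$, and compute $(b_l, c_l)$. 3. If the while-condition fails, return "Infeasible" and stop. *)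

theory Defs
  imports "HOL-Analysis.Analysis"
begin

fun quad :: "real \<times> real \<times> real \<Rightarrow> real \<Rightarrow> real" where
  "quad (a, b, c) x = a * x\<^sup>2 + b * x + c"

datatype outcome = Returned "real \<times> real \<times> real" | Infeasible

record iterate =
  lower_a :: ereal
  upper_a :: real

text \<open>
  The domain is \<open>{xl..xu}\<close> and the local interval is \<open>{tl..tu}\<close>.  The function \<open>f\<close> is only ever
  evaluated inside the domain, and \<open>f'\<close> stands for its derivative relative to the domain
  (one-sided at \<open>xl\<close> and \<open>xu\<close>).
\<close>

locale inner_loop =
  fixes xl xu tl tu eps :: real
    and f f' :: "real \<Rightarrow> real"
begin

definition admissible :: "real \<times> real \<times> real \<Rightarrow> bool" where
  "admissible q \<longleftrightarrow>
     (\<forall>x\<in>{tl..tu}. quad q x \<ge> f x - eps) \<and>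
     (\<forall>x\<in>{xl..xu}. quad q x \<le> f x) \<and>
     quad q tl = f tl - eps \<and> quad q tu = f tu - eps"

definition A :: "real \<Rightarrow> real" where
  "A x = (f x - f tl + eps) / ((x - tl) * (x - tu)) - (f tu - f tl) / ((tu - tl) * (x - tu))"

definition B :: "real \<Rightarrow> real" where
  "B x = (f x - f tl) / ((x - tl) * (x - tu)) - (f tu - f tl) / ((tu - tl) * (x - tu))"

definition bc :: "real \<Rightarrow> real \<times> real" where
  "bc a = (THE (b, c). a * tl\<^sup>2 + b * tl + c = f tl - eps \<and> a * tu\<^sup>2 + b * tu + c = f tu - eps)"

lemma bc_ex1:
  assumes "tl < tu"
  shows "\<exists>!(b, c). a * tl\<^sup>2 + b * tl + c = f tl - eps \<and> a * tu\<^sup>2 + b * tu + c = f tu - eps"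
proof (rule ex1I)
  define b where "b = (f tu - f tl) / (tu - tl) - a * (tl + tu)"
  define c where "c = f tl - eps - a * tl\<^sup>2 - b * tl"
  have b: "b * (tu - tl) = f tu - f tl - a * (tu\<^sup>2 - tl\<^sup>2)"
    using assms by (simp add: b_def field_simps power2_eq_square)
  show "case (b, c) of (b, c) \<Rightarrow>
      a * tl\<^sup>2 + b * tl + c = f tl - eps \<and> a * tu\<^sup>2 + b * tu + c = f tu - eps"
    using b by (simp add: c_def algebra_simps)
  fix z
  assume z: "case z of (b, c) \<Rightarrow>
      a * tl\<^sup>2 + b * tl + c = f tl - eps \<and> a * tu\<^sup>2 + b * tu + c = f tu - eps"
  obtain b' c' where [simp]: "z = (b', c')" by (cases z)
  have "b' * (tu - tl) = b * (tu - tl)"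
    using z b by (simp add: algebra_simps)
  then have "b' = b" using assms by simp
  then show "z = (b, c)" using z by (simp add: c_def)
qed

text \<open>The current \<open>a\<close> of an iterate is always its upper bound.\<close>

definition triple :: "iterate \<Rightarrow> real \<times> real \<times> real" where
  "triple s = (upper_a s, bc (upper_a s))"

definition S_out :: "real set" where "S_out = {xl..xu} - {tl..tu}"
definition S_in :: "real set" where "S_in = {tl<..<tu}"

definition g1 :: "iterate \<Rightarrow> real \<Rightarrow> real" where
  "g1 s x = quad (triple s) x - f x"

definition g3 :: "iterate \<Rightarrow> real \<Rightarrow> real" where
  "g3 s x = f x - quad (triple s) x - eps"

definition v_max :: "iterate \<Rightarrow> ereal" where
  "v_max s = Max {SUP x\<in>S_out. ereal (g1 s x), SUP x\<in>S_in. ereal (g1 s x),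
                  SUP x\<in>S_in. ereal (g3 s x)}"

text \<open>
  \<open>argmax g S xo\<close>: \<open>xo\<close> is some maximizer of \<open>g\<close> over \<open>S\<close>, or \<open>None\<close> if the supremum is not
  attained (in particular if \<open>S\<close> is empty).
\<close>

definition argmax :: "(real \<Rightarrow> real) \<Rightarrow> real set \<Rightarrow> real option \<Rightarrow> bool" where
  "argmax g S xo \<longleftrightarrow>
     (case xo of
        Some x \<Rightarrow> is_arg_max g (\<lambda>y. y \<in> S) x
      | None \<Rightarrow> (\<nexists>x. is_arg_max g (\<lambda>y. y \<in> S) x))"

definition initial :: iterate where
  "initial = \<lparr>lower_a = - \<infinity>,
     upper_a = min ((f tu - f tl + (tl - tu) * f' tl) / (tu - tl)\<^sup>2)
                   ((f tl - f tu + (tu - tl) * f' tu) / (tu - tl)\<^sup>2)\<rparr>"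

definition update :: "real option \<Rightarrow> real option \<Rightarrow> real option \<Rightarrow> iterate \<Rightarrow> iterate" where
  "update x1 x2 x3 s =
     \<lparr>lower_a = Max ({lower_a s} \<union> (\<lambda>x. ereal (A x)) ` set_option x2),
      upper_a = Min ({upper_a s} \<union> A ` set_option x1 \<union> B ` set_option x3)\<rparr>"

definition halt :: "iterate \<Rightarrow> outcome option" where
  "halt s = (if lower_a s \<le> ereal (upper_a s)
             then if v_max s \<le> 0 then Some (Returned (triple s)) else None
             else Some Infeasible)"

definition step :: "iterate \<Rightarrow> iterate \<Rightarrow> bool" where
  "step s s' \<longleftrightarrow> halt s = None \<and>
     (\<exists>x1 x2 x3. argmax (g1 s) S_out x1 \<and> argmax (g1 s) S_in x2 \<and> argmax (g3 s) S_in x3 \<and>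
        s' = update x1 x2 x3 s)"

text \<open>
  A complete run makes \<open>N\<close> updates.  If \<open>N\<close> is finite, it has halted in \<open>s N\<close>, and \<open>s\<close> is irrelevant
  beyond \<open>N\<close>.  Runs need not be unique, since any maximizers may be chosen.
\<close>

definition is_run :: "(nat \<Rightarrow> iterate) \<Rightarrow> enat \<Rightarrow> bool" where
  "is_run s N \<longleftrightarrow> s 0 = initial \<and>
     (\<forall>l. enat l < N \<longrightarrow> step (s l) (s (Suc l))) \<and>
     (\<forall>n. N = enat n \<longrightarrow> halt (s n) \<noteq> None)"

lemma argmax_ex: "\<exists>xo. argmax g S xo"
proof (cases "\<exists>x. is_arg_max g (\<lambda>y. y \<in> S) x")
  case True
  then obtain x where "is_arg_max g (\<lambda>y. y \<in> S) x" ..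
  then have "argmax g S (Some x)" by (simp add: argmax_def)
  then show ?thesis ..
next
  case False
  then have "argmax g S None" by (simp add: argmax_def)
  then show ?thesis ..
qed

lemma step_ex: "halt s = None \<Longrightarrow> \<exists>s'. step s s'"
  unfolding step_def using argmax_ex by metis

lemma is_run_ex: "\<exists>s N. is_run s N"
proof -
  define next_it where "next_it s = (SOME s'. step s s')" for s
  define s where "s l = (next_it ^^ l) initial" for l
  have st: "step (s l) (s (Suc l))" if "halt (s l) = None" for l
    using someI_ex[OF step_ex[OF that]] by (simp add: s_def next_it_def)
  have s0: "s 0 = initial" by (simp add: s_def)
  show ?thesis
  proof (cases "\<exists>n. halt (s n) \<noteq> None")
    case True
    define n where "n = (LEAST n. halt (s n) \<noteq> None)"
    have "halt (s n) \<noteq> None" unfolding n_def using True by (rule LeastI_ex)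
    moreover have "halt (s l) = None" if "l < n" for l
      using not_less_Least[OF that[unfolded n_def]] by simp
    ultimately have "is_run s (enat n)" using st s0 by (auto simp: is_run_def)
    then show ?thesis by blast
  next
    case False
    then have "is_run s \<infinity>" using st s0 by (auto simp: is_run_def)
    then show ?thesis by blast
  qed
qed

end

end

theory Submission
  imports Defs
begin

text \<open>
  Interpolating \<open>f - eps\<close> at both end points leaves one degree of freedom, the leading coefficient
  \<open>a\<close>: with \<open>w x = (x - tl) * (x - tu)\<close> the member of this pencil of parabolas with coefficient
  \<open>a\<close> satisfies \<open>p x - f x = (a - A x) * w x\<close> and \<open>f x - p x - eps = (B x - a) * w x\<close>.  Since \<open>w\<close>
  is positive outside \<open>{tl..tu}\<close> and negative inside, admissibility says that \<open>a\<close> lies below \<open>A\<close>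
  outside and between \<open>A\<close> and \<open>B\<close> inside (lemma \<open>admissible_iff\<close>).  So the admissible
  coefficients form an interval, and the method cuts off pieces of the complementary half-lines.

  No cut removes an admissible coefficient.  The initial upper bound is the smaller of the two
  limits of \<open>B\<close> at the end points (lemma \<open>feasible_le_initial\<close>); every later bound is a value of
  \<open>A\<close> or \<open>B\<close> at one point (lemma \<open>feasible_between_bounds\<close>).  Hence "Infeasible" is returned only
  if nothing is admissible, and a triple is returned only if it is admissible.

  In an infinite run no current coefficient lies below a value of \<open>A\<close> inside, as otherwise the
  bounds would cross after the next update.  The coefficients are therefore bounded below, and since
  they decrease, they converge.  Suppose that the limit violates one of the upper bounds at a point
  \<open>x\<close>, by an amount \<open>d > 0\<close> in terms of function values.  All iterates then violate it at \<open>x\<close> by at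
  least \<open>d\<close>, and so does each maximizer.  As \<open>\<bar>w\<bar>\<close> is bounded on the domain by some \<open>W\<close>, each update
  decreases \<open>a\<close> by at least \<open>d / W\<close>, which contradicts convergence.  Hence the limit is
  admissible, and in particular an infeasible problem has no infinite run.
\<close>

section \<open>Attained maxima\<close>

text \<open>
  The sets over which the method maximizes are not closed, but on the end points that they miss the
  objective is nonpositive.  A positive value hence forces the maximum to be attained.
\<close>

lemma arg_max_ex_if_positive:
  fixes g :: "'a::topological_space \<Rightarrow> real"
  assumes "compact K" and "continuous_on K g" and "S \<subseteq> K"
    and nonpos: "\<And>y. y \<in> K - S \<Longrightarrow> g y \<le> 0"
    and "x \<in> S" and "g x > 0"
  shows "\<exists>z. is_arg_max g (\<lambda>y. y \<in> S) z"
proof -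
  have "K \<noteq> {}" using assms by blast
  then obtain z where z: "z \<in> K" "\<And>y. y \<in> K \<Longrightarrow> g y \<le> g z"
    using continuous_attains_sup[OF assms(1) _ assms(2)] by blast
  have "g z > 0" using z(2)[of x] assms by auto
  then have "z \<in> S" using nonpos[of z] z(1) by force
  then show ?thesis using z(2) \<open>S \<subseteq> K\<close> by (auto simp: is_arg_max_linorder)
qed

section \<open>The pencil of interpolating parabolas\<close>

locale inner_loop_problem = inner_loop +
  assumes f_deriv: "\<And>x. x \<in> {xl..xu} \<Longrightarrow> (f has_real_derivative f' x) (at x within {xl..xu})"
    and eps_pos: "eps > 0"
    and loc_subset: "{tl..tu} \<subseteq> {xl..xu}"
    and tl_less_tu: "tl < tu"
begin

abbreviation w :: "real \<Rightarrow> real" where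
  "w x \<equiv> (x - tl) * (x - tu)"

definition pencil :: "real \<Rightarrow> real \<times> real \<times> real" where
  "pencil a = (a, bc a)"

definition feasible :: "real \<Rightarrow> bool" where
  "feasible a \<longleftrightarrow> (\<forall>x\<in>S_out. a \<le> A x) \<and> (\<forall>x\<in>S_in. A x \<le> a \<and> a \<le> B x)"

lemma triple_eq: "triple s = pencil (upper_a s)"
  by (simp add: triple_def pencil_def)

lemma bc_eqI:
  assumes "a * tl\<^sup>2 + b * tl + c = f tl - eps" and "a * tu\<^sup>2 + b * tu + c = f tu - eps"
  shows "bc a = (b, c)"
  unfolding bc_def using assms by (intro the1_equality[OF bc_ex1[OF tl_less_tu]]) simp

lemma bc_eq:
  "bc a = ((f tu - f tl) / (tu - tl) - a * (tl + tu),
           f tl - eps - (f tu - f tl) / (tu - tl) * tl + a * tl * tu)"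
proof (rule bc_eqI)
  have "(f tu - f tl) / (tu - tl) * (tu - tl) = f tu - f tl"
    using tl_less_tu by simp
  then show "a * tu\<^sup>2 + ((f tu - f tl) / (tu - tl) - a * (tl + tu)) * tu +
      (f tl - eps - (f tu - f tl) / (tu - tl) * tl + a * tl * tu) = f tu - eps"
    by (simp only: ring_distribs power2_eq_square)
qed (simp add: algebra_simps power2_eq_square)

lemma pencil_tendsto:
  assumes "(a \<longlongrightarrow> a') F"
  shows "((\<lambda>l. pencil (a l)) \<longlongrightarrow> pencil a') F"
  unfolding pencil_def bc_eq by (intro tendsto_intros assms)

lemma quad_pencil:
  "quad (pencil a) x = f tl + (f tu - f tl) / (tu - tl) * (x - tl) - eps + a * w x"
proof -
  define m where "m = (f tu - f tl) / (tu - tl)"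
  show ?thesis
    unfolding pencil_def bc_eq m_def[symmetric]
    by (simp add: algebra_simps power2_eq_square)
qed

lemma quad_pencil_ends [simp]:
  "quad (pencil a) tl = f tl - eps" "quad (pencil a) tu = f tu - eps"
  using tl_less_tu by (simp_all add: quad_pencil)

lemma
  assumes "x \<noteq> tl" and "x \<noteq> tu"
  shows quad_pencil_A: "quad (pencil a) x - f x = (a - A x) * w x"
    and quad_pencil_B: "f x - quad (pencil a) x - eps = (B x - a) * w x"
proof -
  define m where "m = (f tu - f tl) / (tu - tl)"
  have w: "y / w x * w x = y" for y using assms by simp
  have "m / (x - tu) * w x = m * (x - tl)" using assms by simp
  moreover have "A x = (f x - f tl + eps) / w x - m / (x - tu)"
    "B x = (f x - f tl) / w x - m / (x - tu)"
    by (simp_all add: A_def B_def m_def)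
  ultimately have "A x * w x = f x - f tl + eps - m * (x - tl)"
    "B x * w x = f x - f tl - m * (x - tl)"
    using w by (simp_all only: left_diff_distrib)
  then show "quad (pencil a) x - f x = (a - A x) * w x"
    "f x - quad (pencil a) x - eps = (B x - a) * w x"
    unfolding quad_pencil m_def[symmetric] by (simp_all only: left_diff_distrib)
qed

lemma w_pos: "x \<in> S_out \<Longrightarrow> w x > 0"
  using tl_less_tu by (auto simp: S_out_def zero_less_mult_iff)

lemma w_neg: "x \<in> S_in \<Longrightarrow> w x < 0"
  by (auto simp: S_in_def mult_less_0_iff)

lemma not_end:
  "x \<in> S_out \<Longrightarrow> x \<noteq> tl \<and> x \<noteq> tu" "x \<in> S_in \<Longrightarrow> x \<noteq> tl \<and> x \<noteq> tu"
  using tl_less_tu by (auto simp: S_out_def S_in_def)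

lemma S_subset: "S_out \<subseteq> {xl..xu}" "S_in \<subseteq> {xl..xu}"
  using loc_subset by (auto simp: S_out_def S_in_def)

lemma
  shows above_out_iff: "x \<in> S_out \<Longrightarrow> quad (pencil a) x \<le> f x \<longleftrightarrow> a \<le> A x"
    and above_in_iff: "x \<in> S_in \<Longrightarrow> quad (pencil a) x \<le> f x \<longleftrightarrow> A x \<le> a"
    and below_in_iff: "x \<in> S_in \<Longrightarrow> f x - eps \<le> quad (pencil a) x \<longleftrightarrow> a \<le> B x"
proof -
  assume x: "x \<in> S_out"
  have "quad (pencil a) x \<le> f x \<longleftrightarrow> (a - A x) * w x \<le> 0"
    using quad_pencil_A[of x a] not_end(1)[OF x] by linarith
  then show "quad (pencil a) x \<le> f x \<longleftrightarrow> a \<le> A x"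
    using w_pos[OF x] by (simp only: mult_le_0_iff[of _ "w x"]) argo
next
  assume x: "x \<in> S_in"
  have "quad (pencil a) x \<le> f x \<longleftrightarrow> (a - A x) * w x \<le> 0"
    using quad_pencil_A[of x a] not_end(2)[OF x] by linarith
  then show "quad (pencil a) x \<le> f x \<longleftrightarrow> A x \<le> a"
    using w_neg[OF x] by (simp only: mult_le_0_iff[of _ "w x"]) argo
  have "f x - eps \<le> quad (pencil a) x \<longleftrightarrow> (B x - a) * w x \<le> 0"
    using quad_pencil_B[of x a] not_end(2)[OF x] by linarith
  then show "f x - eps \<le> quad (pencil a) x \<longleftrightarrow> a \<le> B x"
    using w_neg[OF x] by (simp only: mult_le_0_iff[of _ "w x"]) argo
qed

lemma domain_eq: "{xl..xu} = S_out \<union> S_in \<union> {tl, tu}"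
  using loc_subset tl_less_tu by (auto simp: S_out_def S_in_def)

lemma loc_eq: "{tl..tu} = S_in \<union> {tl, tu}"
  using tl_less_tu by (auto simp: S_in_def)

lemma admissible_pencil_iff: "admissible (pencil a) \<longleftrightarrow> feasible a"
  unfolding admissible_def feasible_def domain_eq loc_eq
  using eps_pos by (auto simp: ball_Un above_out_iff above_in_iff below_in_iff)

lemma admissible_iff: "admissible q \<longleftrightarrow> (\<exists>a. q = pencil a \<and> feasible a)"
proof -
  obtain a b c where q: "q = (a, b, c)" by (cases q)
  have "q = pencil a" if "admissible q"
    using that bc_eqI[of a b c] by (simp add: q admissible_def pencil_def)
  then show ?thesis using admissible_pencil_iff by metis
qed

section \<open>The bounds enclose all feasible coefficients\<close>

text \<open>
  At an end point \<open>f x - quad (pencil a) x - eps\<close> vanishes, and inside it is nonpositive.  So its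
  one-sided derivatives at \<open>tl\<close> and \<open>tu\<close> have the sign that makes \<open>a\<close> a lower bound for the two
  initial fractions, which are the limits of \<open>B\<close>.
\<close>

lemma feasible_le_initial:
  assumes "feasible a"
  shows "a \<le> upper_a initial"
proof -
  define m where "m = (f tu - f tl) / (tu - tl)"
  have tl: "tl \<in> {xl..xu}" and tu: "tu \<in> {xl..xu}" using loc_subset tl_less_tu by auto
  have sub: "{tl<..<tu} \<subseteq> {xl..xu}" using loc_subset by auto
  have inside: "f x - f tl - m * (x - tl) \<le> a * w x" if "x \<in> {tl<..<tu}" for x
  proof -
    have "x \<in> S_in" using that by (simp add: S_in_def)
    then have "f x - eps \<le> quad (pencil a) x"
      using assms below_in_iff by (simp add: feasible_def)
    then show ?thesis by (simp add: quad_pencil m_def)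
  qed
  have "((\<lambda>x. (f x - f tl) / (x - tl)) \<longlongrightarrow> f' tl) (at tl within {tl<..<tu})"
    using has_field_derivative_subset[OF f_deriv[OF tl] sub] by (simp add: has_field_derivative_iff)
  moreover have "((\<lambda>x. m + a * (x - tu)) \<longlongrightarrow> m + a * (tl - tu)) (at tl within {tl<..<tu})"
    by (intro tendsto_intros)
  moreover have "\<forall>\<^sub>F x in at tl within {tl<..<tu}. (f x - f tl) / (x - tl) \<le> m + a * (x - tu)"
  proof (rule eventually_at_topological[THEN iffD2], intro exI[of _ UNIV] conjI ballI impI)
    fix x assume x: "x \<in> {tl<..<tu}"
    have "f x - f tl \<le> (m + a * (x - tu)) * (x - tl)" using inside[OF x] by (simp add: algebra_simps)
    then show "(f x - f tl) / (x - tl) \<le> m + a * (x - tu)"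
      using x by (simp add: pos_divide_le_eq)
  qed auto
  moreover have "at tl within {tl<..<tu} \<noteq> bot"
    using tl_less_tu by (simp add: at_within_eq_bot_iff)
  ultimately have L: "f' tl \<le> m + a * (tl - tu)"
    using tendsto_le by blast
  have "((\<lambda>x. (f x - f tu) / (x - tu)) \<longlongrightarrow> f' tu) (at tu within {tl<..<tu})"
    using has_field_derivative_subset[OF f_deriv[OF tu] sub] by (simp add: has_field_derivative_iff)
  moreover have "((\<lambda>x. m + a * (x - tl)) \<longlongrightarrow> m + a * (tu - tl)) (at tu within {tl<..<tu})"
    by (intro tendsto_intros)
  moreover have "\<forall>\<^sub>F x in at tu within {tl<..<tu}. m + a * (x - tl) \<le> (f x - f tu) / (x - tu)"
  proof (rule eventually_at_topological[THEN iffD2], intro exI[of _ UNIV] conjI ballI impI)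
    fix x assume x: "x \<in> {tl<..<tu}"
    have "m * (tu - tl) = f tu - f tl" using tl_less_tu by (simp add: m_def)
    then have "f x - f tu \<le> (m + a * (x - tl)) * (x - tu)"
      using inside[OF x] by (simp add: algebra_simps)
    then show "m + a * (x - tl) \<le> (f x - f tu) / (x - tu)"
      using x by (simp add: neg_le_divide_eq)
  qed auto
  moreover have "at tu within {tl<..<tu} \<noteq> bot"
    using tl_less_tu by (simp add: at_within_eq_bot_iff)
  ultimately have R: "m + a * (tu - tl) \<le> f' tu"
    using tendsto_le by blast
  define h where "h = tu - tl"
  have h: "h > 0" using tl_less_tu by (simp add: h_def)
  have m: "m * h = f tu - f tl" using h by (simp add: m_def h_def)
  have "f' tl * h \<le> (m - a * h) * h" using L h by (intro mult_right_mono) (simp_all add: h_def algebra_simps)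
  then have "a * h\<^sup>2 \<le> f tu - f tl - h * f' tl" using m by (simp add: algebra_simps power2_eq_square)
  then have "a \<le> (f tu - f tl + (tl - tu) * f' tl) / h\<^sup>2"
    using h by (simp add: h_def pos_le_divide_eq algebra_simps)
  moreover have "(m + a * h) * h \<le> f' tu * h" using R h by (intro mult_right_mono) (simp_all add: h_def)
  then have "a * h\<^sup>2 \<le> f tl - f tu + h * f' tu" using m by (simp add: algebra_simps power2_eq_square)
  then have "a \<le> (f tl - f tu + (tu - tl) * f' tu) / h\<^sup>2"
    using h by (simp add: h_def pos_le_divide_eq)
  ultimately show ?thesis by (simp add: initial_def h_def)
qed

lemma argmax_mem: "argmax g S xo \<Longrightarrow> x \<in> set_option xo \<Longrightarrow> x \<in> S"
  by (auto simp: argmax_def is_arg_max_def split: option.splits)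

lemma feasible_between_step:
  assumes "feasible a" and "step s s'" and "lower_a s \<le> ereal a" and "a \<le> upper_a s"
  shows "lower_a s' \<le> ereal a \<and> a \<le> upper_a s'"
proof -
  obtain x1 x2 x3 where am: "argmax (g1 s) S_out x1" "argmax (g1 s) S_in x2"
      "argmax (g3 s) S_in x3" and s': "s' = update x1 x2 x3 s"
    using assms(2) by (auto simp: step_def)
  show ?thesis
    unfolding s' update_def
    using assms(1,3,4) am[THEN argmax_mem] by (auto simp: feasible_def)
qed

lemma feasible_between_bounds:
  assumes "feasible a" and run: "is_run s N" and "enat n \<le> N"
  shows "lower_a (s n) \<le> ereal a \<and> a \<le> upper_a (s n)"
  using \<open>enat n \<le> N\<close>
proof (induction n)
  case 0
  then show ?case
    using run feasible_le_initial[OF assms(1)] by (simp add: is_run_def initial_def)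
next
  case (Suc n)
  then have "enat n < N" by (metis Suc_ile_eq)
  then show ?case
    using Suc.IH run feasible_between_step[OF assms(1)] by (auto simp: is_run_def)
qed

section \<open>Outcomes\<close>

lemma v_max_nonpos_iff: "v_max s \<le> 0 \<longleftrightarrow> feasible (upper_a s)"
proof -
  have "v_max s \<le> 0 \<longleftrightarrow>
      (\<forall>x\<in>S_out. g1 s x \<le> 0) \<and> (\<forall>x\<in>S_in. g1 s x \<le> 0) \<and> (\<forall>x\<in>S_in. g3 s x \<le> 0)"
    by (simp add: v_max_def SUP_le_iff)
  also have "\<dots> \<longleftrightarrow> feasible (upper_a s)"
    using above_out_iff[of _ "upper_a s"] above_in_iff[of _ "upper_a s"]
      below_in_iff[of _ "upper_a s"]
    by (force simp: g1_def g3_def triple_eq feasible_def algebra_simps)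
  finally show ?thesis .
qed

lemma Returned_admissible: "halt s = Some (Returned q) \<Longrightarrow> admissible q"
  by (auto simp: halt_def triple_eq admissible_pencil_iff v_max_nonpos_iff split: if_splits)

lemma Infeasible_imp:
  assumes "is_run s (enat n)" and "halt (s n) = Some Infeasible"
  shows "\<not> feasible a"
proof
  assume "feasible a"
  then have "lower_a (s n) \<le> ereal a" "a \<le> upper_a (s n)"
    using feasible_between_bounds assms(1) by auto
  then have "lower_a (s n) \<le> ereal (upper_a (s n))"
    by (meson ereal_less_eq(3) order_trans)
  then show False using assms(2) by (simp add: halt_def split: if_splits)
qed

section \<open>Effect of one update\<close>

lemma g_continuous: "continuous_on {xl..xu} (g1 s)" "continuous_on {xl..xu} (g3 s)"
proof -
  have "continuous_on {xl..xu} f"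
    by (rule DERIV_continuous_on[OF f_deriv])
  then show "continuous_on {xl..xu} (g1 s)" "continuous_on {xl..xu} (g3 s)"
    unfolding g1_def g3_def triple_eq quad_pencil using tl_less_tu by (auto intro!: continuous_intros)
qed

lemma g_ends: "x \<in> {tl, tu} \<Longrightarrow> g1 s x \<le> 0" "x \<in> {tl, tu} \<Longrightarrow> g3 s x \<le> 0"
  using eps_pos by (auto simp: g1_def g3_def triple_eq)

lemma argmax_dominates:
  assumes "argmax g S xo" and "continuous_on K g" and "compact K" and "S \<subseteq> K"
    and "\<And>y. y \<in> K - S \<Longrightarrow> g y \<le> 0" and "x \<in> S" and "g x > 0"
  obtains z where "xo = Some z" and "z \<in> S" and "g x \<le> g z"
proof -
  have "\<exists>z. is_arg_max g (\<lambda>y. y \<in> S) z"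
    using assms by (intro arg_max_ex_if_positive[of K])
  then obtain z where "xo = Some z" "is_arg_max g (\<lambda>y. y \<in> S) z"
    using assms(1) by (auto simp: argmax_def split: option.splits)
  then show ?thesis using that \<open>x \<in> S\<close> by (auto simp: is_arg_max_linorder)
qed

lemma argmax_out_dominates:
  assumes "argmax (g1 s) S_out xo" and "x \<in> S_out" and "g1 s x > 0"
  obtains z where "xo = Some z" and "z \<in> S_out" and "g1 s x \<le> g1 s z"
proof (rule argmax_dominates[OF assms(1), where K = "{xl..tl} \<union> {tu..xu}"])
  show "continuous_on ({xl..tl} \<union> {tu..xu}) (g1 s)"
    using loc_subset tl_less_tu by (intro continuous_on_subset[OF g_continuous(1)]) auto
  show "g1 s y \<le> 0" if "y \<in> {xl..tl} \<union> {tu..xu} - S_out" for y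
    using that loc_subset tl_less_tu by (intro g_ends(1)) (auto simp: S_out_def)
qed (use assms that in \<open>auto simp: S_out_def\<close>)

lemma argmax_in_dominates:
  assumes "argmax g S_in xo" and "g = g1 s \<or> g = g3 s" and "x \<in> S_in" and "g x > 0"
  obtains z where "xo = Some z" and "z \<in> S_in" and "g x \<le> g z"
proof (rule argmax_dominates[OF assms(1), where K = "{tl..tu}"])
  show "continuous_on {tl..tu} g"
    using assms(2) g_continuous continuous_on_subset loc_subset by blast
  show "g y \<le> 0" if "y \<in> {tl..tu} - S_in" for y
    using that assms(2) g_ends by (auto simp: loc_eq)
qed (use assms that in \<open>auto simp: S_in_def\<close>)

lemma upper_a_antimono_step: "step s s' \<Longrightarrow> upper_a s' \<le> upper_a s"
  by (auto simp: step_def update_def)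

text \<open>
  A violated lower bound ends the run: the new lower bound is then above the current coefficient,
  which is the old upper bound.
\<close>

lemma bounds_cross:
  assumes "step s s'" and "x \<in> S_in" and "upper_a s < A x"
  shows "ereal (upper_a s') < lower_a s'"
proof -
  obtain x1 x2 x3 where am: "argmax (g1 s) S_in x2" and s': "s' = update x1 x2 x3 s"
    using assms(1) by (auto simp: step_def)
  have pos: "g1 s x > 0"
    using above_in_iff[OF assms(2), of "upper_a s"] assms(3) by (simp add: g1_def triple_eq)
  obtain z where z: "x2 = Some z" "z \<in> S_in" "g1 s x \<le> g1 s z"
    using argmax_in_dominates[OF am _ assms(2) pos] by blast
  have "upper_a s < A z"
    using above_in_iff[OF z(2), of "upper_a s"] z(3) pos by (simp add: g1_def triple_eq)
  then have "ereal (upper_a s') < ereal (A z)"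
    using upper_a_antimono_step[OF assms(1)] by simp
  also have "ereal (A z) \<le> lower_a s'" by (simp add: s' update_def z(1))
  finally show ?thesis .
qed

definition W :: real where "W = (xu - xl)\<^sup>2"

lemma W_pos: "W > 0"
  using tl_less_tu loc_subset by (auto simp: W_def)

lemma abs_w_le_W: "x \<in> {xl..xu} \<Longrightarrow> \<bar>w x\<bar> \<le> W"
  using loc_subset tl_less_tu unfolding W_def abs_mult power2_eq_square
  by (intro mult_mono) auto

text \<open>
  The violation at the maximizer \<open>z\<close> is the gap between \<open>a\<close> and the new bound, multiplied by
  \<open>\<bar>w z\<bar>\<close>.  As \<open>z\<close> may tend to an end point, where \<open>w\<close> vanishes, no lower bound on \<open>\<bar>w z\<bar>\<close> is
  at hand; but dividing by \<open>\<bar>w z\<bar>\<close> needs only the upper bound \<open>W\<close>.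
\<close>

lemma step_decrease_out:
  assumes "step s s'" and "x \<in> S_out" and "0 < d" and "d \<le> g1 s x"
  shows "upper_a s' \<le> upper_a s - d / W"
proof -
  obtain x1 x2 x3 where am: "argmax (g1 s) S_out x1" and s': "s' = update x1 x2 x3 s"
    using assms(1) by (auto simp: step_def)
  have pos: "g1 s x > 0" using assms(3,4) by simp
  obtain z where z: "x1 = Some z" "z \<in> S_out" "g1 s x \<le> g1 s z"
    using argmax_out_dominates[OF am assms(2) pos] by blast
  have le: "d \<le> (upper_a s - A z) * w z"
    using z(3) assms(4) quad_pencil_A[of z "upper_a s"] not_end(1)[OF z(2)]
    by (simp add: g1_def triple_eq)
  have wz: "0 < w z" "w z \<le> W" using w_pos[OF z(2)] abs_w_le_W[of z] S_subset z(2) by auto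
  have "0 < upper_a s - A z"
    using le assms(3) wz(1) by (metis less_le_trans zero_less_mult_pos2)
  then have "d \<le> (upper_a s - A z) * W"
    using le wz mult_left_mono[OF wz(2), of "upper_a s - A z"] by linarith
  then have "d / W \<le> upper_a s - A z" using W_pos by (simp add: pos_divide_le_eq)
  moreover have "upper_a s' \<le> A z" by (simp add: s' update_def z(1))
  ultimately show ?thesis by simp
qed

lemma step_decrease_in:
  assumes "step s s'" and "x \<in> S_in" and "0 < d" and "d \<le> g3 s x"
  shows "upper_a s' \<le> upper_a s - d / W"
proof -
  obtain x1 x2 x3 where am: "argmax (g3 s) S_in x3" and s': "s' = update x1 x2 x3 s"
    using assms(1) by (auto simp: step_def)
  have pos: "g3 s x > 0" using assms(3,4) by simp
  obtain z where z: "x3 = Some z" "z \<in> S_in" "g3 s x \<le> g3 s z"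
    using argmax_in_dominates[OF am _ assms(2) pos] by blast
  have le: "d \<le> (upper_a s - B z) * (- w z)"
    using z(3) assms(4) quad_pencil_B[of z "upper_a s"] not_end(2)[OF z(2)]
    by (simp add: g3_def triple_eq algebra_simps)
  have wz: "0 < - w z" "- w z \<le> W" using w_neg[OF z(2)] abs_w_le_W[of z] S_subset z(2) by auto
  have "0 < upper_a s - B z"
    using le assms(3) wz(1) by (metis less_le_trans zero_less_mult_pos2)
  then have "d \<le> (upper_a s - B z) * W"
    using le wz mult_left_mono[OF wz(2), of "upper_a s - B z"] by linarith
  then have "d / W \<le> upper_a s - B z" using W_pos by (simp add: pos_divide_le_eq)
  moreover have "upper_a s' \<le> B z" by (simp add: s' update_def z(1))
  ultimately show ?thesis by simp
qed

section \<open>Infinite runs\<close>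

text \<open>A convergent sequence cannot decrease by a fixed positive amount in every step.\<close>

lemma no_uniform_decrease:
  fixes a :: "nat \<Rightarrow> real"
  assumes "a \<longlonglongrightarrow> L" and "\<And>l. a (Suc l) \<le> a l - c" and "0 < c"
  shows False
proof -
  have "(\<lambda>l. a l - a (Suc l)) \<longlonglongrightarrow> L - L"
    by (intro tendsto_diff assms(1) LIMSEQ_Suc)
  then have "c \<le> L - L"
    by (rule LIMSEQ_le_const) (use assms(2) in \<open>auto simp: algebra_simps\<close>)
  then show False using assms(3) by simp
qed

lemma infinite_run_converges:
  assumes run: "is_run s \<infinity>"
  shows "\<exists>a. feasible a \<and> (\<lambda>l. upper_a (s l)) \<longlonglongrightarrow> a"
proof -
  let ?a = "\<lambda>l. upper_a (s l)"
  have st: "step (s l) (s (Suc l))" for l using run by (simp add: is_run_def)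
  have dec: "decseq ?a" by (intro decseq_SucI upper_a_antimono_step st)
  have lower: "A x \<le> ?a l" if "x \<in> S_in" for x l
  proof (rule ccontr)
    assume "\<not> A x \<le> ?a l"
    then have "ereal (?a (Suc l)) < lower_a (s (Suc l))"
      using bounds_cross[OF st that] by simp
    then have "halt (s (Suc l)) \<noteq> None" by (auto simp: halt_def)
    then show False using st[of "Suc l"] by (simp add: step_def)
  qed
  have "(tl + tu) / 2 \<in> S_in" using tl_less_tu by (simp add: S_in_def)
  then obtain a where lim: "?a \<longlonglongrightarrow> a" and le: "\<And>l. a \<le> ?a l"
    using decseq_convergent[OF dec, of "A ((tl + tu) / 2)"] lower by blast
  have "a \<le> A x" if x: "x \<in> S_out" for x
  proof (rule ccontr)
    assume "\<not> a \<le> A x"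
    define d where "d = quad (pencil a) x - f x"
    have d: "d > 0" using above_out_iff[OF x, of a] \<open>\<not> a \<le> A x\<close> by (simp add: d_def)
    \<comment> \<open>Outside, the parabolas increase with their leading coefficient.\<close>
    have "d \<le> g1 (s l) x" for l
      using mult_right_mono[OF le[of l], of "w x"] w_pos[OF x]
      by (simp add: d_def g1_def triple_eq quad_pencil)
    then have "?a (Suc l) \<le> ?a l - d / W" for l
      by (rule step_decrease_out[OF st x d])
    then show False using no_uniform_decrease[OF lim, of "d / W"] d W_pos by simp
  qed
  moreover have "a \<le> B x" if x: "x \<in> S_in" for x
  proof (rule ccontr)
    assume "\<not> a \<le> B x"
    define d where "d = f x - quad (pencil a) x - eps"
    have d: "d > 0" using below_in_iff[OF x, of a] \<open>\<not> a \<le> B x\<close> by (simp add: d_def)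
    \<comment> \<open>Inside, they decrease with it.\<close>
    have "d \<le> g3 (s l) x" for l
      using mult_right_mono_neg[OF le[of l], of "w x"] w_neg[OF x]
      by (simp add: d_def g3_def triple_eq quad_pencil)
    then have "?a (Suc l) \<le> ?a l - d / W" for l
      by (rule step_decrease_in[OF st x d])
    then show False using no_uniform_decrease[OF lim, of "d / W"] d W_pos by simp
  qed
  moreover have "A x \<le> a" if "x \<in> S_in" for x
    by (rule LIMSEQ_le_const[OF lim]) (use lower[OF that] in auto)
  ultimately show ?thesis using lim by (auto simp: feasible_def)
qed

end

section \<open>Correctness of the method\<close>

theorem theorem3:
  fixes xl xu tl tu eps :: real
    and f f' :: "real \<Rightarrow> real"
    and s :: "nat \<Rightarrow> iterate"
    and N :: enat
  assumes "\<And>x. x \<in> {xl..xu} \<Longrightarrow> (f has_real_derivative f' x) (at x within {xl..xu})"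
    and "continuous_on {xl..xu} f'"
    and "eps > 0"
    and "{tl..tu} \<subseteq> {xl..xu}"
    and "tl < tu"
    and "inner_loop.is_run xl xu tl tu eps f f' s N"
  shows "((\<exists>q. inner_loop.admissible xl xu tl tu eps f q) \<longrightarrow>
            (\<exists>n q. N = enat n \<and> inner_loop.halt xl xu tl tu eps f (s n) = Some (Returned q) \<and>
                   inner_loop.admissible xl xu tl tu eps f q) \<or>
            (N = \<infinity> \<and> (\<exists>q. inner_loop.admissible xl xu tl tu eps f q \<and>
                           (\<lambda>l. inner_loop.triple tl tu eps f (s l)) \<longlonglongrightarrow> q))) \<and>
         ((\<nexists>q. inner_loop.admissible xl xu tl tu eps f q) \<longrightarrow>
            (\<exists>n. N = enat n \<and> inner_loop.halt xl xu tl tu eps f (s n) = Some Infeasible))"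
proof -
  interpret inner_loop_problem xl xu tl tu eps f f'
    using assms(1,3-5) by unfold_locales
  have run: "is_run s N" by fact
  have "\<exists>a. feasible a \<and> N = \<infinity> \<and> (\<lambda>l. triple (s l)) \<longlonglongrightarrow> pencil a" if "N = \<infinity>"
    using infinite_run_converges[of s] pencil_tendsto run that unfolding triple_eq by blast
  moreover have "(\<exists>q. halt (s n) = Some (Returned q) \<and> admissible q) \<or>
      halt (s n) = Some Infeasible \<and> (\<nexists>q. admissible q)" if "N = enat n" for n
  proof -
    have "halt (s n) \<noteq> None" using run that by (simp add: is_run_def)
    then consider q where "halt (s n) = Some (Returned q)" | "halt (s n) = Some Infeasible"
      by (metis option.exhaust outcome.exhaust)
    then show ?thesis
    proof cases
      case 1
      then show ?thesis using Returned_admissible by blast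
    next
      case 2
      then show ?thesis using Infeasible_imp[of s n] run that admissible_iff by blast
    qed
  qed
  ultimately show ?thesis
    by (cases N) (use admissible_pencil_iff in blast)+
qed

end
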